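(* Let $p\in[-1,1]$ and $q=\sqrt{1-p^2}$, and let $\Pi_1$ be the leading component of the stationary Schur--Weyl representation of $\mathfrak S_{\mathbb N}$ with parameters $p,q$. Let $L_N=Ne-\sum_{k=1}^{N}\sigma_k\in\mathbb C[\mathfrak S_N]$ be the Coxeter--Laplace operator. Then the weak limit as $N\to\infty$ of the operators $\frac1N\Pi_1(L_N)$ is the scalar operator $\phi(p)E$, where $E$ is the identity operator and $$\phi(p)=\frac{13}{12}+\frac86p^4-\frac76p^2-\frac{\sqrt3}{2}\,p\sqrt{1-p^2}.$$
   Context: $\mathfrak S_{\mathbb N}=\bigcup_N\mathfrak S_N$. Here $\sigma_k=(k,k+1)$ for $1\le k\le N-1$ and $\sigma_N=(N,1)$ are the (periodic) Coxeter transpositions in $\mathfrak S_N$, and $e$ is the identity. For a Young diagram $\lambda$ with $N$ cells, $\pi_\lambda$ is the irreducible unitary representation of $\mathfrak S_N$ with its Young orthogonal basis consisting of the standard Young tableaux of shape $\lambda$. For $j\ge0$, $\lambda=(j+1,j)$, $\mu=(j+2,j+1)$, $n=2j+1$, and a tableau $t$ of shape $\lambda$, let $t\cdot t_{21}$ be the tableau of shape $\mu$ obtained from $t$ by putting $n+1$ into the second row and $n+2$ into the first row, and $t\cdot t_{12}$ the tableau obtained by putting $n+1$ into the first row and $n+2$ into the second row. The map $t\mapsto p\,(t\cdot t_{21})+q\,(t\cdot t_{12})$ extends to an isometric $\mathfrak S_n$-equivariant embedding $i_n:\pi_{(j+1,j)}\hookrightarrow\pi_{(j+2,j+1)}$.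 The representation $\Pi_1$ (leading component of the stationary Schur--Weyl representation, in the odd case, with parameters $p,q$) is the unitary representation of $\mathfrak S_{\mathbb N}$ on the Hilbert space completion of the inductive limit of $\pi_{(1)}\hookrightarrow\pi_{(2,1)}\hookrightarrow\pi_{(3,2)}\hookrightarrow\cdots$ under the embeddings $i_1,i_3,i_5,\dots$ (with the same $p,q$ at every step). *)

theory Defs
  imports
    "HOL-Analysis.Analysis"
    "HOL-Algebra.Sym_Groups"
    "HOL-Library.Poly_Mapping"
begin

section \<open>Complex Hilbert spaces and unitary representations\<close>

text \<open>The inner product is linear in the first argument and conjugate-linear in the second.\<close>

class complex_hilbert_space = banach +
  fixes scaleC :: "complex \<Rightarrow> 'a \<Rightarrow> 'a"
    and cinner :: "'a \<Rightarrow> 'a \<Rightarrow> complex"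
  assumes scaleC_add_right: "scaleC a (x + y) = scaleC a x + scaleC a y"
    and scaleC_add_left: "scaleC (a + b) x = scaleC a x + scaleC b x"
    and scaleC_scaleC: "scaleC a (scaleC b x) = scaleC (a * b) x"
    and scaleC_of_real: "scaleC (complex_of_real r) x = scaleR r x"
    and cinner_commute: "cinner x y = cnj (cinner y x)"
    and cinner_add_left: "cinner (x + y) z = cinner x z + cinner y z"
    and cinner_scaleC_left: "cinner (scaleC a x) y = a * cinner x y"
    and cinner_norm: "cinner x x = complex_of_real ((norm x)\<^sup>2)"

text \<open>
  Linear maps and representations are considered on a subspace \<open>V\<close> of the ambient type;
  \<open>sc\<close> is the complex scalar multiplication and \<open>ip\<close> the inner product.
\<close>

definition linear_isometry_on ::
  "'v::ab_group_add set \<Rightarrow> (complex \<Rightarrow> 'v \<Rightarrow> 'v) \<Rightarrow> ('v \<Rightarrow> 'v \<Rightarrow> complex) \<Rightarrow>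
   (complex \<Rightarrow> 'w \<Rightarrow> 'w) \<Rightarrow> ('w \<Rightarrow> 'w \<Rightarrow> complex) \<Rightarrow> ('v \<Rightarrow> 'w::ab_group_add) \<Rightarrow> bool"
  where "linear_isometry_on V sc ip sc' ip' T \<longleftrightarrow>
    (\<forall>v\<in>V. \<forall>w\<in>V. T (v + w) = T v + T w) \<and>
    (\<forall>c. \<forall>v\<in>V. T (sc c v) = sc' c (T v)) \<and>
    (\<forall>v\<in>V. \<forall>w\<in>V. ip' (T v) (T w) = ip v w)"

definition unitary_rep ::
  "('g, 'm) monoid_scheme \<Rightarrow> 'v::ab_group_add set \<Rightarrow> (complex \<Rightarrow> 'v \<Rightarrow> 'v) \<Rightarrow>
   ('v \<Rightarrow> 'v \<Rightarrow> complex) \<Rightarrow> ('g \<Rightarrow> 'v \<Rightarrow> 'v) \<Rightarrow> bool"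
  where "unitary_rep G V sc ip \<rho> \<longleftrightarrow>
    (\<forall>g\<in>carrier G. linear_isometry_on V sc ip sc ip (\<rho> g) \<and> \<rho> g ` V = V) \<and>
    (\<forall>v\<in>V. \<rho> \<one>\<^bsub>G\<^esub> v = v) \<and>
    (\<forall>g\<in>carrier G. \<forall>h\<in>carrier G. \<forall>v\<in>V. \<rho> (g \<otimes>\<^bsub>G\<^esub> h) v = \<rho> g (\<rho> h v))"

definition weak_operator_limit ::
  "(nat \<Rightarrow> 'h \<Rightarrow> 'h::complex_hilbert_space) \<Rightarrow> ('h \<Rightarrow> 'h) \<Rightarrow> bool"
  where "weak_operator_limit A T \<longleftrightarrow>
    (\<forall>x y. (\<lambda>N. cinner (A N x) y) \<longlonglongrightarrow> cinner (T x) y)"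


section \<open>The infinite symmetric group and the Coxeter--Laplace operator\<close>

definition sym_group_inf :: "(nat \<Rightarrow> nat) monoid"
  where "sym_group_inf = \<lparr> carrier = (\<Union>N. carrier (sym_group N)), mult = (\<circ>), one = id \<rparr>"

definition coxeter :: "nat \<Rightarrow> nat \<Rightarrow> (nat \<Rightarrow> nat)"
  where "coxeter N k = (if k < N then Transposition.transpose k (k + 1) else Transposition.transpose N 1)"

text \<open>
  An element of a complex group algebra is a finitely supported function from the group to the
  complex numbers.
\<close>

definition coxeter_laplace :: "nat \<Rightarrow> (nat \<Rightarrow> nat) \<Rightarrow>\<^sub>0 complex"
  where "coxeter_laplace N =
    Poly_Mapping.single id (of_nat N) - (\<Sum>k=1..N. Poly_Mapping.single (coxeter N k) 1)"

definition extend_rep ::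
  "('g \<Rightarrow> 'h \<Rightarrow> 'h) \<Rightarrow> ('g \<Rightarrow>\<^sub>0 complex) \<Rightarrow> 'h \<Rightarrow> 'h::complex_hilbert_space"
  where "extend_rep \<rho> a x =
    (\<Sum>g\<in>Poly_Mapping.keys a. scaleC (Poly_Mapping.lookup a g) (\<rho> g x))"


section \<open>Standard Young tableaux and Young's orthogonal form\<close>

text \<open>
  A diagram is given by its list of row lengths (trailing empty rows are harmless); the cell
  \<open>(r, c)\<close> lies in row \<open>r\<close> and column \<open>c\<close>, both counted from 0.  A tableau maps the cells
  to their entries and is 0 outside the diagram.
\<close>

definition cells :: "nat list \<Rightarrow> (nat \<times> nat) set"
  where "cells \<mu> = {(r, c). r < length \<mu> \<and> c < \<mu> ! r}"

type_synonym tableau = "nat \<times> nat \<Rightarrow> nat"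

definition standard_tableaux :: "nat list \<Rightarrow> tableau set"
  where "standard_tableaux \<mu> =
    {t. bij_betw t (cells \<mu>) {1..sum_list \<mu>} \<and> (\<forall>x. x \<notin> cells \<mu> \<longrightarrow> t x = 0) \<and>
        (\<forall>r c c'. (r, c) \<in> cells \<mu> \<and> (r, c') \<in> cells \<mu> \<and> c < c' \<longrightarrow> t (r, c) < t (r, c')) \<and>
        (\<forall>r r' c. (r, c) \<in> cells \<mu> \<and> (r', c) \<in> cells \<mu> \<and> r < r' \<longrightarrow> t (r, c) < t (r', c))}"

definition entry_content :: "nat list \<Rightarrow> tableau \<Rightarrow> nat \<Rightarrow> int"
  where "entry_content \<mu> t k = (case the_inv_into (cells \<mu>) t k of (r, c) \<Rightarrow> int c - int r)"

definition axial_distance :: "nat list \<Rightarrow> tableau \<Rightarrow> nat \<Rightarrow> int"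
  where "axial_distance \<mu> t k = entry_content \<mu> t (k + 1) - entry_content \<mu> t k"

text \<open>
  The space of the representation associated with \<open>\<mu>\<close> consists of the formal complex linear
  combinations of standard tableaux of shape \<open>\<mu>\<close>, which form an orthonormal basis.
\<close>

type_synonym tableau_vec = "tableau \<Rightarrow>\<^sub>0 complex"

definition tableau_space :: "nat list \<Rightarrow> tableau_vec set"
  where "tableau_space \<mu> = {v. Poly_Mapping.keys v \<subseteq> standard_tableaux \<mu>}"

definition vec_scale :: "complex \<Rightarrow> tableau_vec \<Rightarrow> tableau_vec"
  where "vec_scale c v = Poly_Mapping.map ((*) c) v"

definition vec_inner :: "tableau_vec \<Rightarrow> tableau_vec \<Rightarrow> complex"
  where "vec_inner v w =
    (\<Sum>t\<in>Poly_Mapping.keys v. Poly_Mapping.lookup v t * cnj (Poly_Mapping.lookup w t))"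

text \<open>
  The irreducible representation associated with \<open>\<mu>\<close> is the one whose Coxeter generators act
  on the tableau basis by Young's orthogonal form; since these generate the symmetric group, this
  determines every operator \<open>\<rho> g\<close> on the representation space.  If the swapped tableau is not
  standard, then the axial distance is \<open>1\<close> or \<open>-1\<close> and the second summand below vanishes.
\<close>

definition young_orthogonal_rep ::
  "nat list \<Rightarrow> ((nat \<Rightarrow> nat) \<Rightarrow> tableau_vec \<Rightarrow> tableau_vec) \<Rightarrow> bool"
  where "young_orthogonal_rep \<mu> \<rho> \<longleftrightarrow>
    unitary_rep (sym_group (sum_list \<mu>)) (tableau_space \<mu>) vec_scale vec_inner \<rho> \<and>
    (\<forall>t\<in>standard_tableaux \<mu>. \<forall>k. 1 \<le> k \<and> k < sum_list \<mu> \<longrightarrow>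
       (let d = real_of_int (axial_distance \<mu> t k) in
        \<rho> (Transposition.transpose k (k + 1)) (Poly_Mapping.single t 1) =
          Poly_Mapping.single t (complex_of_real (1 / d)) +
          Poly_Mapping.single (Transposition.transpose k (k + 1) \<circ> t) (complex_of_real (sqrt (1 - 1 / d\<^sup>2)))))"


section \<open>The leading component of the stationary Schur--Weyl representation\<close>

definition two_row :: "nat \<Rightarrow> nat list"
  where "two_row j = [j + 1, j]"

text \<open>
  For \<open>t\<close> of shape \<open>(j + 1, j)\<close>, with \<open>n = 2 j + 1\<close> cells, the new cells are \<open>(0, j + 1)\<close> in
  the first row and \<open>(1, j)\<close> in the second row.
\<close>

definition append_21 :: "nat \<Rightarrow> tableau \<Rightarrow> tableau"
  where "append_21 j t = t((1, j) := 2 * j + 2, (0, j + 1) := 2 * j + 3)"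

definition append_12 :: "nat \<Rightarrow> tableau \<Rightarrow> tableau"
  where "append_12 j t = t((0, j + 1) := 2 * j + 2, (1, j) := 2 * j + 3)"

text \<open>The linear extension of \<open>t \<mapsto> p (t \<cdot> t\<^sub>2\<^sub>1) + q (t \<cdot> t\<^sub>1\<^sub>2)\<close>.\<close>

definition stationary_embedding :: "real \<Rightarrow> real \<Rightarrow> nat \<Rightarrow> tableau_vec \<Rightarrow> tableau_vec"
  where "stationary_embedding p q j v =
    (\<Sum>t\<in>Poly_Mapping.keys v. vec_scale (Poly_Mapping.lookup v t)
       (Poly_Mapping.single (append_21 j t) (complex_of_real p) +
        Poly_Mapping.single (append_12 j t) (complex_of_real q)))"

text \<open>
  The completion of the inductive limit is characterised, up to a unique isometric isomorphism,
  as a complete space \<open>'h\<close> with isometries \<open>J j\<close> from the finite-dimensional spaces that are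
  compatible with the embeddings and whose ranges have dense union.
\<close>

definition inductive_limit_completion ::
  "real \<Rightarrow> real \<Rightarrow> (nat \<Rightarrow> tableau_vec \<Rightarrow> 'h::complex_hilbert_space) \<Rightarrow> bool"
  where "inductive_limit_completion p q J \<longleftrightarrow>
    (\<forall>j. linear_isometry_on (tableau_space (two_row j)) vec_scale vec_inner scaleC cinner (J j)) \<and>
    (\<forall>j. \<forall>v\<in>tableau_space (two_row j). J (j + 1) (stationary_embedding p q j v) = J j v) \<and>
    closure (\<Union>j. J j ` tableau_space (two_row j)) = UNIV"

definition leading_component ::
  "real \<Rightarrow> real \<Rightarrow> ((nat \<Rightarrow> nat) \<Rightarrow> 'h \<Rightarrow> 'h::complex_hilbert_space) \<Rightarrow> bool"
  where "leading_component p q Pi1 \<longleftrightarrow>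
    unitary_rep sym_group_inf UNIV scaleC cinner Pi1 \<and>
    (\<exists>\<pi> J. (\<forall>j. young_orthogonal_rep (two_row j) (\<pi> j)) \<and>
      inductive_limit_completion p q J \<and>
      (\<forall>j. \<forall>g\<in>carrier (sym_group (2 * j + 1)). \<forall>v\<in>tableau_space (two_row j).
         Pi1 g (J j v) = J j (\<pi> j g v)))"

definition phi :: "real \<Rightarrow> real"
  where "phi p = 13/12 + 8/6 * p ^ 4 - 7/6 * p\<^sup>2 - sqrt 3 / 2 * p * sqrt (1 - p\<^sup>2)"

end

theory Submission
  imports Defs
begin

text \<open>
  A stage of the inductive limit is the space of tableaux of shape \<open>(j + 1, j)\<close>. In the limit space
  a tableau \<open>t\<close> of this stage becomes \<open>t\<close> followed by infinitely many independent copies of the unit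
  vector \<open>p e\<^sub>2\<^sub>1 + q e\<^sub>1\<^sub>2\<close>: each step adds a cell to both rows, in one of the two orders. Young's
  orthogonal form sees only the cells of \<open>k\<close> and \<open>k + 1\<close>, so a generator \<open>\<sigma>\<^sub>k\<close> whose two entries were
  both added after a stage moves added entries only, and its compression to that stage is exactly a
  scalar. There are two such scalars.

  If \<open>k\<close> and \<open>k + 1\<close> belong to one step, \<open>\<sigma>\<^sub>k\<close> acts on \<open>e\<^sub>2\<^sub>1, e\<^sub>1\<^sub>2\<close> by the matrix with diagonal \<open>1/2, -1/2\<close>
  and off-diagonal entries \<open>\<surd>3/2\<close>; its expectation in \<open>p e\<^sub>2\<^sub>1 + q e\<^sub>1\<^sub>2\<close> is the scalar
  (\<open>cinner_even_generator\<close>). If they belong to consecutive steps, the diagonal entries for the four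
  pairs of orders are \<open>-1, 1, 1, 1/3\<close>; in the last case Young's form produces a further tableau, which
  is orthogonal to everything that the embeddings produce, so that the scalar is the mean of these
  entries with weights \<open>p\<^sup>4, p\<^sup>2q\<^sup>2, p\<^sup>2q\<^sup>2, q\<^sup>4\<close> (\<open>cinner_odd_generator\<close>).

  For fixed vectors of one stage the matrix elements of \<open>\<sigma>\<^sub>k\<close> are therefore 2-periodic in \<open>k\<close> from
  some point on, their averages converge to the mean of the two scalars
  (\<open>cesaro_eventually_two_periodic\<close>), and the single generator \<open>(N, 1)\<close> is lost after division by \<open>N\<close>.
  The operators \<open>L\<^sub>N / N\<close> have norm at most 2, so the limit extends from the dense union of the stages
  to the whole space (\<open>tendsto_zero_from_dense\<close>).
\<close>

section \<open>Complex Hilbert spaces\<close>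

lemma scaleC_one [simp]: "scaleC 1 (x :: 'h::complex_hilbert_space) = x"
  using scaleC_of_real[of 1 x] by simp

lemma scaleC_zero_left [simp]: "scaleC 0 (x :: 'h::complex_hilbert_space) = 0"
  using scaleC_of_real[of 0 x] by simp

lemma scaleC_zero_right [simp]: "scaleC a (0 :: 'h::complex_hilbert_space) = 0"
  using scaleC_add_right[of a "0::'h" 0] by simp

lemma scaleC_minus_left: "scaleC (- a) (x :: 'h::complex_hilbert_space) = - scaleC a x"
  using scaleC_add_left[of "- a" a x] by (simp add: eq_neg_iff_add_eq_0)

lemma cinner_zero_left [simp]: "cinner (0 :: 'h::complex_hilbert_space) y = 0"
  using cinner_add_left[of "0::'h" 0 y] by simp

lemma cinner_minus_left: "cinner (- x :: 'h::complex_hilbert_space) y = - cinner x y"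
  using cinner_add_left[of "- x" x y] by (simp add: eq_neg_iff_add_eq_0)

lemma cinner_diff_left: "cinner (x - x' :: 'h::complex_hilbert_space) y = cinner x y - cinner x' y"
  using cinner_add_left[of x "- x'" y] by (simp add: cinner_minus_left)

lemma cinner_sum_left: "cinner (\<Sum>i\<in>I. f i :: 'h::complex_hilbert_space) y = (\<Sum>i\<in>I. cinner (f i) y)"
  by (induction I rule: infinite_finite_induct) (auto simp: cinner_add_left)

lemma cinner_add_right: "cinner (x :: 'h::complex_hilbert_space) (y + z) = cinner x y + cinner x z"
  by (metis cinner_add_left cinner_commute complex_cnj_add)

lemma cinner_diff_right: "cinner (x :: 'h::complex_hilbert_space) (y - z) = cinner x y - cinner x z"
  by (metis cinner_diff_left cinner_commute complex_cnj_diff)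

lemma cinner_zero_right [simp]: "cinner (x :: 'h::complex_hilbert_space) 0 = 0"
  using cinner_add_right[of x 0 0] by simp

lemma cinner_scaleC_right: "cinner (x :: 'h::complex_hilbert_space) (scaleC a y) = cnj a * cinner x y"
  by (metis cinner_commute cinner_scaleC_left complex_cnj_mult)

lemma cinner_sum_right: "cinner (x :: 'h::complex_hilbert_space) (\<Sum>i\<in>I. f i) = (\<Sum>i\<in>I. cinner x (f i))"
  by (induction I rule: infinite_finite_induct) (auto simp: cinner_add_right)

lemma norm_scaleC: "norm (scaleC a (x :: 'h::complex_hilbert_space)) = norm a * norm x"
proof -
  have "complex_of_real ((norm (scaleC a x))\<^sup>2) = (a * cnj a) * cinner x x"
    unfolding cinner_norm[symmetric] by (simp add: cinner_scaleC_left cinner_scaleC_right)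
  also have "\<dots> = complex_of_real ((norm a * norm x)\<^sup>2)"
    by (simp add: cinner_norm complex_norm_square power_mult_distrib flip: of_real_power)
  finally have "(norm (scaleC a x))\<^sup>2 = (norm a * norm x)\<^sup>2"
    using of_real_eq_iff by blast
  then show ?thesis
    by (simp add: power2_eq_iff_nonneg)
qed

text \<open>
  Subtracting from \<open>x\<close> its orthogonal projection to the line of \<open>y\<close> leaves a vector whose squared
  norm is the difference of the two sides.
\<close>

lemma cinner_Cauchy_Schwarz: "norm (cinner (x :: 'h::complex_hilbert_space) y) \<le> norm x * norm y"
proof (cases "y = 0")
  case False
  define a where "a = cinner x y"
  define z where "z = x - scaleC (a / (norm y)\<^sup>2) y"
  have zy: "cinner z y = 0"
    using False by (simp add: z_def cinner_diff_left cinner_scaleC_left cinner_norm a_def)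
  have "complex_of_real ((norm z)\<^sup>2) = cinner z x"
    by (subst cinner_norm[symmetric], subst (2) z_def)
      (simp add: cinner_diff_right cinner_scaleC_right zy)
  also have "\<dots> = cinner x x - a / (norm y)\<^sup>2 * cnj a"
    using cinner_commute[of y x] by (simp add: z_def cinner_diff_left cinner_scaleC_left a_def)
  also have "\<dots> = complex_of_real ((norm x)\<^sup>2 - (norm a)\<^sup>2 / (norm y)\<^sup>2)"
    by (simp add: cinner_norm complex_norm_square flip: of_real_power)
  finally have "(norm x)\<^sup>2 - (norm a)\<^sup>2 / (norm y)\<^sup>2 = (norm z)\<^sup>2"
    using of_real_eq_iff by metis
  then have "(norm a)\<^sup>2 / (norm y)\<^sup>2 \<le> (norm x)\<^sup>2"
    using zero_le_power2[of "norm z"] by linarith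
  then have "(norm a)\<^sup>2 \<le> (norm x * norm y)\<^sup>2"
    using False by (simp add: divide_simps power_mult_distrib split: if_splits)
  then show ?thesis
    unfolding a_def by (rule power2_le_imp_le) simp
qed simp


section \<open>Limits\<close>

text \<open>
  The Lipschitz constant does not depend on the index, so a nearby point of the dense set controls
  the whole sequence; this upgrades weak convergence from a dense set of vectors.
\<close>

lemma tendsto_zero_from_dense:
  fixes f :: "nat \<Rightarrow> 'h::real_normed_vector \<Rightarrow> 'c::real_normed_vector"
  assumes lip: "\<And>N x x'. norm (f N x - f N x') \<le> C * norm (x - x')"
    and dense: "closure D = UNIV"
    and conv: "\<And>x. x \<in> D \<Longrightarrow> (\<lambda>N. f N x) \<longlonglongrightarrow> 0"
  shows "(\<lambda>N. f N x) \<longlonglongrightarrow> 0"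
proof (rule LIMSEQ_I)
  fix \<epsilon> :: real
  assume "\<epsilon> > 0"
  define \<delta> where "\<delta> = \<epsilon> / (2 * (\<bar>C\<bar> + 1))"
  have "\<delta> > 0"
    using \<open>\<epsilon> > 0\<close> by (simp add: \<delta>_def)
  then obtain x' where x': "x' \<in> D" "norm (x' - x) < \<delta>"
    using dense closure_approachable[of x D] by (auto simp: dist_norm)
  obtain M where M: "\<And>N. N \<ge> M \<Longrightarrow> norm (f N x') < \<epsilon> / 2"
    using LIMSEQ_D[OF conv[OF x'(1)], of "\<epsilon> / 2"] \<open>\<epsilon> > 0\<close> by auto
  have "norm (f N x - 0) < \<epsilon>" if "N \<ge> M" for N
  proof -
    have "norm (f N x - f N x') \<le> (\<bar>C\<bar> + 1) * norm (x - x')"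
      by (rule order_trans[OF lip]) (intro mult_right_mono; simp)
    also have "\<dots> \<le> (\<bar>C\<bar> + 1) * \<delta>"
      using x'(2) by (intro mult_left_mono) (auto simp: norm_minus_commute)
    also have "\<dots> = \<epsilon> / 2"
      by (simp add: \<delta>_def field_simps)
    finally have "norm (f N x - f N x') \<le> \<epsilon> / 2" .
    moreover have "norm (f N x) \<le> norm (f N x - f N x') + norm (f N x')"
      using norm_triangle_ineq[of "f N x - f N x'" "f N x'"] by simp
    ultimately show ?thesis
      using M[OF that] by simp
  qed
  then show "\<exists>M. \<forall>N\<ge>M. norm (f N x - 0) < \<epsilon>"
    by blast
qed

text \<open>
  The partial sums of \<open>a k - (\<alpha> + \<beta>) / 2\<close> are eventually periodic with period 2, hence bounded.
\<close>

lemma cesaro_eventually_two_periodic: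
  fixes a :: "nat \<Rightarrow> complex"
  assumes even: "\<And>i. i \<ge> m \<Longrightarrow> a (2 * i) = \<alpha>"
    and odd: "\<And>i. i \<ge> m \<Longrightarrow> a (2 * i + 1) = \<beta>"
  shows "(\<lambda>N. (\<Sum>k=1..<N. a k) / of_nat N) \<longlonglongrightarrow> (\<alpha> + \<beta>) / 2"
proof -
  define b where "b = (\<lambda>k. a k - (\<alpha> + \<beta>) / 2)"
  define r where "r = (\<lambda>N. \<Sum>k=1..<N. b k)"
  have b: "b k + b (k + 1) = 0" if "k \<ge> 2 * m" for k
  proof (cases "even k")
    case True
    then obtain i where "k = 2 * i" by auto
    with that even[of i] odd[of i] show ?thesis
      by (simp add: b_def field_simps)
  next
    case False
    then obtain i where "k = 2 * i + 1" using oddE by blast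
    with that even[of "i + 1"] odd[of i] show ?thesis
      by (simp add: b_def field_simps)
  qed
  have per: "r (N + 2) = r N" if "N \<ge> 2 * m + 1" for N
    using that b[of N] by (simp add: r_def)
  have range: "r N \<in> r ` {..2 * m + 2}" for N
  proof (induction N rule: less_induct)
    case (less N)
    show ?case
    proof (cases "N \<le> 2 * m + 2")
      case False
      then have "r N = r (N - 2)"
        using per[of "N - 2"] by (simp add: numeral_2_eq_2 Suc_diff_Suc)
      then show ?thesis
        using less[of "N - 2"] False by simp
    qed simp
  qed
  have "finite (range r)"
    by (rule finite_subset[of _ "r ` {..2 * m + 2}"]) (use range in auto)
  then have "Bseq r"
    by (simp add: Bseq_eq_bounded finite_imp_bounded)
  then have lim0: "(\<lambda>N. r N / of_nat N) \<longlonglongrightarrow> 0"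
    unfolding divide_inverse
    using bounded_bilinear.Bfun_prod_Zfun[OF bounded_bilinear_mult, of r sequentially "\<lambda>N. inverse (of_nat N)"]
      lim_inverse_n by (simp add: tendsto_Zfun_iff)
  have "(\<lambda>N. r N / of_nat N + (\<alpha> + \<beta>) / 2 - inverse (of_nat N) * ((\<alpha> + \<beta>) / 2))
      \<longlonglongrightarrow> 0 + (\<alpha> + \<beta>) / 2 - 0 * ((\<alpha> + \<beta>) / 2)"
    by (intro tendsto_intros lim0 lim_inverse_n)
  moreover have "\<forall>\<^sub>F N in sequentially.
      r N / of_nat N + (\<alpha> + \<beta>) / 2 - inverse (of_nat N) * ((\<alpha> + \<beta>) / 2) = (\<Sum>k=1..<N. a k) / of_nat N"
    using eventually_ge_at_top[of 1]
  proof eventually_elim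
    case (elim N)
    have "r N = (\<Sum>k=1..<N. a k) - (of_nat N - 1) * ((\<alpha> + \<beta>) / 2)"
      using elim by (simp add: r_def b_def sum_subtractf of_nat_diff)
    then show ?case
      using elim by (simp add: field_simps)
  qed
  ultimately show ?thesis
    by (simp add: tendsto_cong)
qed


section \<open>Tableaux with two rows\<close>

lemma cells_two_row: "cells (two_row j) = {0} \<times> {..j} \<union> {1} \<times> {..<j}"
proof -
  have "(r, c) \<in> cells (two_row j) \<longleftrightarrow> (r, c) \<in> {0} \<times> {..j} \<union> {1} \<times> {..<j}" for r c
    by (cases r) (auto simp: cells_def two_row_def)
  then show ?thesis
    by auto
qed

lemma cells_two_row_Suc:
  "cells (two_row (j + 1)) = insert (0, j + 1) (insert (1, j) (cells (two_row j)))"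
  by (auto simp: cells_two_row)

lemma sum_list_two_row: "sum_list (two_row j) = 2 * j + 1"
  by (simp add: two_row_def)

lemma standard_tableau_le:
  assumes "t \<in> standard_tableaux (two_row j)"
  shows "t x \<le> 2 * j + 1"
proof (cases "x \<in> cells (two_row j)")
  case True
  then have "t x \<in> {1..2 * j + 1}"
    using assms unfolding standard_tableaux_def bij_betw_def by (auto simp: sum_list_two_row)
  then show ?thesis by simp
qed (use assms in \<open>cases x, auto simp: standard_tableaux_def\<close>)

text \<open>Each of the two new cells ends its row and its column, so that both may carry the new entries.\<close>

lemma standard_tableau_append_two:
  assumes t: "t \<in> standard_tableaux (two_row j)"
    and xy: "{x, y} = {(0, j + 1), (1, j)}"
  shows "t(x := 2 * j + 2, y := 2 * j + 3) \<in> standard_tableaux (two_row (j + 1))"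
proof -
  define u where "u = t(x := 2 * j + 2, y := 2 * j + 3)"
  have ne: "x \<noteq> y"
    using xy by (auto simp: doubleton_eq_iff)
  have new: "x \<notin> cells (two_row j)" "y \<notin> cells (two_row j)"
    using xy by (auto simp: doubleton_eq_iff cells_two_row)
  have cells: "cells (two_row (j + 1)) = insert y (insert x (cells (two_row j)))"
    using xy unfolding cells_two_row_Suc doubleton_eq_iff by (auto simp only: insert_commute)
  have bij: "bij_betw t (cells (two_row j)) {1..2 * j + 1}"
    and out: "\<And>z. z \<notin> cells (two_row j) \<Longrightarrow> t z = 0"
    and row: "\<And>r c c'. (r, c) \<in> cells (two_row j) \<Longrightarrow> (r, c') \<in> cells (two_row j) \<Longrightarrow> c < c' \<Longrightarrow> t (r, c) < t (r, c')"
    and col: "\<And>r r' c. (r, c) \<in> cells (two_row j) \<Longrightarrow> (r', c) \<in> cells (two_row j) \<Longrightarrow> r < r' \<Longrightarrow> t (r, c) < t (r', c)"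
    using t by (auto simp: standard_tableaux_def sum_list_two_row)
  have le: "t z < 2 * j + 2" "t z < 2 * j + 3" for z
    using standard_tableau_le[OF t, of z] by auto
  have old: "u z = t z" if "z \<in> cells (two_row j)" for z
    using that new by (auto simp: u_def)
  have "bij_betw u (cells (two_row j)) {1..2 * j + 1}"
    using bij old bij_betw_cong by metis
  then have "bij_betw u (insert x (cells (two_row j))) (insert (2 * j + 2) {1..2 * j + 1})"
    using notIn_Un_bij_betw[of x "cells (two_row j)" u "{1..2 * j + 1}"] new ne by (simp add: u_def)
  then have "bij_betw u (insert y (insert x (cells (two_row j)))) (insert (2 * j + 3) (insert (2 * j + 2) {1..2 * j + 1}))"
    using notIn_Un_bij_betw[of y "insert x (cells (two_row j))" u "insert (2 * j + 2) {1..2 * j + 1}"] new ne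
    by (simp add: u_def)
  moreover have "insert (2 * j + 3) (insert (2 * j + 2) {1..2 * j + 1}) = {1..2 * (j + 1) + 1}"
    by auto
  ultimately have "bij_betw u (cells (two_row (j + 1))) {1..2 * (j + 1) + 1}"
    by (simp only: cells)
  moreover have "u z = 0" if "z \<notin> cells (two_row (j + 1))" for z
    using that out[of z] unfolding cells by (simp add: u_def)
  moreover have "u (r, c) < u (r, c')"
    if "(r, c) \<in> cells (two_row (j + 1))" "(r, c') \<in> cells (two_row (j + 1))" "c < c'" for r c c'
  proof -
    have "(r, c) \<in> cells (two_row j)"
      using that by (auto simp: cells_two_row)
    then show ?thesis
      using that row[of r c c'] le[of "(r, c)"] old[of "(r, c)"] unfolding cells by (auto simp: u_def)
  qed
  moreover have "u (r, c) < u (r', c)"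
    if "(r, c) \<in> cells (two_row (j + 1))" "(r', c) \<in> cells (two_row (j + 1))" "r < r'" for r r' c
  proof -
    have "(r, c) \<in> cells (two_row j)"
      using that by (auto simp: cells_two_row)
    then show ?thesis
      using that col[of r c r'] le[of "(r, c)"] old[of "(r, c)"] unfolding cells by (auto simp: u_def)
  qed
  ultimately have "u \<in> standard_tableaux (two_row (j + 1))"
    unfolding standard_tableaux_def by (auto simp: sum_list_two_row)
  then show ?thesis
    by (simp add: u_def)
qed

lemma append_standard:
  assumes "t \<in> standard_tableaux (two_row j)"
  shows "append_21 j t \<in> standard_tableaux (two_row (j + 1))"
    and "append_12 j t \<in> standard_tableaux (two_row (j + 1))"
  unfolding append_21_def append_12_def
  by (rule standard_tableau_append_two[OF assms]; auto)+

lemma append_values [simp]: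
  "append_21 j t (1, j) = 2 * j + 2" "append_21 j t (0, j + 1) = 2 * j + 3"
  "append_12 j t (0, j + 1) = 2 * j + 2" "append_12 j t (1, j) = 2 * j + 3"
  "append_21 j t (Suc 0, j) = 2 * j + 2" "append_21 j t (0, Suc j) = 2 * j + 3"
  "append_12 j t (0, Suc j) = 2 * j + 2" "append_12 j t (Suc 0, j) = 2 * j + 3"
  by (auto simp: append_21_def append_12_def)

lemma append_distinct [simp]: "append_21 j t \<noteq> append_12 j s" "append_12 j s \<noteq> append_21 j t"
proof -
  have "append_21 j t (1, j) \<noteq> append_12 j s (1, j)"
    by simp
  then show "append_21 j t \<noteq> append_12 j s" "append_12 j s \<noteq> append_21 j t"
    by metis+
qed

lemma append_inject [simp]:
  assumes "t \<in> standard_tableaux (two_row j)" "s \<in> standard_tableaux (two_row j)"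
  shows "append_21 j t = append_21 j s \<longleftrightarrow> t = s" and "append_12 j t = append_12 j s \<longleftrightarrow> t = s"
proof -
  have out: "u(x := 0, y := 0) = u" if "u \<in> standard_tableaux (two_row j)"
    "x = (0, j + 1)" "y = (1, j)" for u x y
    using that by (auto simp: standard_tableaux_def cells_two_row fun_eq_iff)
  have "(append_21 j u)((0, j + 1) := 0, (1, j) := 0) = u"
    "(append_12 j u)((0, j + 1) := 0, (1, j) := 0) = u"
    if "u \<in> standard_tableaux (two_row j)" for u
    using out[OF that refl refl] by (auto simp: append_21_def append_12_def fun_eq_iff)
  then show "append_21 j t = append_21 j s \<longleftrightarrow> t = s" "append_12 j t = append_12 j s \<longleftrightarrow> t = s"
    using assms by metis+
qed

lemma transpose_append:
  assumes "t \<in> standard_tableaux (two_row j)"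
  shows "Transposition.transpose (2 * j + 2) (2 * j + 3) \<circ> append_21 j t = append_12 j t"
    and "Transposition.transpose (2 * j + 2) (2 * j + 3) \<circ> append_12 j t = append_21 j t"
proof -
  have "t x \<noteq> 2 * j + 2" "t x \<noteq> 2 * j + 3" for x
    using standard_tableau_le[OF assms, of x] by auto
  then show "Transposition.transpose (2 * j + 2) (2 * j + 3) \<circ> append_21 j t = append_12 j t"
    "Transposition.transpose (2 * j + 2) (2 * j + 3) \<circ> append_12 j t = append_21 j t"
    by (auto simp: fun_eq_iff append_21_def append_12_def Transposition.transpose_def)
qed

lemma axial_distance_eq:
  assumes t: "t \<in> standard_tableaux \<mu>"
    and "(r, c) \<in> cells \<mu>" "t (r, c) = k" "(r', c') \<in> cells \<mu>" "t (r', c') = k + 1"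
  shows "axial_distance \<mu> t k = (int c' - int r') - (int c - int r)"
proof -
  have "inj_on t (cells \<mu>)"
    using t by (auto simp: standard_tableaux_def bij_betw_def)
  then show ?thesis
    using assms by (simp add: axial_distance_def entry_content_def the_inv_into_f_eq)
qed


section \<open>Group algebra elements in a representation\<close>

lemma transpose_in_sym_group:
  "1 \<le> a \<Longrightarrow> a \<le> n \<Longrightarrow> 1 \<le> b \<Longrightarrow> b \<le> n \<Longrightarrow> Transposition.transpose a b \<in> carrier (sym_group n)"
  by (simp add: sym_group_carrier permutes_swap_id)

lemma coxeter_in_sym_group: "1 \<le> k \<Longrightarrow> k \<le> N \<Longrightarrow> coxeter N k \<in> carrier (sym_group N)"
  unfolding coxeter_def by (auto intro: transpose_in_sym_group)

lemma extend_rep_superset: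
  assumes "finite S" "Poly_Mapping.keys a \<subseteq> S"
  shows "extend_rep \<rho> a x = (\<Sum>g\<in>S. scaleC (Poly_Mapping.lookup a g) (\<rho> g x))"
  unfolding extend_rep_def using assms by (intro sum.mono_neutral_left) (auto simp: in_keys_iff)

lemma extend_rep_diff: "extend_rep \<rho> (a - b) x = extend_rep \<rho> a x - extend_rep \<rho> b x"
proof -
  define S where "S = Poly_Mapping.keys a \<union> Poly_Mapping.keys b"
  have S: "finite S" "Poly_Mapping.keys a \<subseteq> S" "Poly_Mapping.keys b \<subseteq> S" "Poly_Mapping.keys (a - b) \<subseteq> S"
    using keys_diff[of a b] by (auto simp: S_def)
  have "scaleC (c - d) z = scaleC c z - scaleC d z" for c d and z :: 'a
    using scaleC_add_left[of c "- d" z] by (simp add: scaleC_minus_left)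
  then show ?thesis
    using S by (simp add: extend_rep_superset[of S] lookup_minus sum_subtractf)
qed

lemma extend_rep_sum: "extend_rep \<rho> (\<Sum>i\<in>I. f i) x = (\<Sum>i\<in>I. extend_rep \<rho> (f i) x)"
proof (induction I rule: infinite_finite_induct)
  case (insert i I)
  \<comment> \<open>Addition as subtraction of a negative, so that \<open>extend_rep_diff\<close> applies.\<close>
  have "extend_rep \<rho> (f i - (- sum f I)) x = extend_rep \<rho> (f i) x - (extend_rep \<rho> 0 x - extend_rep \<rho> (sum f I) x)"
    by (simp only: extend_rep_diff flip: diff_0)
  then show ?case
    using insert by (simp add: extend_rep_def[of _ 0])
qed (simp_all add: extend_rep_def)

lemma extend_rep_single: "extend_rep \<rho> (Poly_Mapping.single g c) x = scaleC c (\<rho> g x)"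
  by (simp add: extend_rep_def)


section \<open>The tableau basis inside the limit space\<close>

lemma single_in_tableau_space: "t \<in> standard_tableaux \<mu> \<Longrightarrow> Poly_Mapping.single t c \<in> tableau_space \<mu>"
  by (simp add: tableau_space_def)

lemma tableau_space_add: "v \<in> tableau_space \<mu> \<Longrightarrow> w \<in> tableau_space \<mu> \<Longrightarrow> v + w \<in> tableau_space \<mu>"
  using keys_add[of v w] by (auto simp: tableau_space_def)

lemma tableau_space_sum:
  "(\<And>i. i \<in> I \<Longrightarrow> f i \<in> tableau_space \<mu>) \<Longrightarrow> (\<Sum>i\<in>I. f i) \<in> tableau_space \<mu>"
  using keys_sum[of f I] by (fastforce simp: tableau_space_def)

lemma vec_scale_single: "vec_scale c (Poly_Mapping.single t d) = Poly_Mapping.single t (c * d)"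
  by (simp add: vec_scale_def)

lemma vec_inner_single: "vec_inner (Poly_Mapping.single t 1) (Poly_Mapping.single s 1) = (if t = s then 1 else 0)"
  by (simp add: vec_inner_def lookup_single)

lemma tableau_vec_eq_sum_single: "v = (\<Sum>t\<in>Poly_Mapping.keys v. Poly_Mapping.single t (Poly_Mapping.lookup v t))"
  for v :: tableau_vec
proof (rule poly_mapping_eqI)
  fix s
  have "(\<Sum>t\<in>Poly_Mapping.keys v. if t = s then Poly_Mapping.lookup v t else 0) = Poly_Mapping.lookup v s"
    by (simp add: in_keys_iff)
  then show "Poly_Mapping.lookup v s =
      Poly_Mapping.lookup (\<Sum>t\<in>Poly_Mapping.keys v. Poly_Mapping.single t (Poly_Mapping.lookup v t)) s"
    by (simp add: lookup_sum lookup_single when_def)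
qed

locale leading_component_model =
  fixes p q :: real
    and Pi1 :: "(nat \<Rightarrow> nat) \<Rightarrow> 'h \<Rightarrow> 'h::complex_hilbert_space"
    and \<pi> :: "nat \<Rightarrow> (nat \<Rightarrow> nat) \<Rightarrow> tableau_vec \<Rightarrow> tableau_vec"
    and J :: "nat \<Rightarrow> tableau_vec \<Rightarrow> 'h"
  assumes unitary: "unitary_rep sym_group_inf UNIV scaleC cinner Pi1"
    and young: "young_orthogonal_rep (two_row j) (\<pi> j)"
    and limit: "inductive_limit_completion p q J"
    and intertwines: "g \<in> carrier (sym_group (2 * j + 1)) \<Longrightarrow> v \<in> tableau_space (two_row j) \<Longrightarrow>
      Pi1 g (J j v) = J j (\<pi> j g v)"
begin

definition basis_vec :: "nat \<Rightarrow> tableau \<Rightarrow> 'h"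
  where "basis_vec j t = J j (Poly_Mapping.single t 1)"

lemma Pi1_isometry:
  assumes "g \<in> carrier (sym_group n)"
  shows "Pi1 g (x + y) = Pi1 g x + Pi1 g y" "Pi1 g (scaleC c x) = scaleC c (Pi1 g x)"
    "cinner (Pi1 g x) (Pi1 g y) = cinner x y"
proof -
  have "g \<in> carrier sym_group_inf"
    using assms by (auto simp: sym_group_inf_def)
  then have "linear_isometry_on UNIV scaleC cinner scaleC cinner (Pi1 g)"
    using unitary by (auto simp: unitary_rep_def)
  then show "Pi1 g (x + y) = Pi1 g x + Pi1 g y" "Pi1 g (scaleC c x) = scaleC c (Pi1 g x)"
    "cinner (Pi1 g x) (Pi1 g y) = cinner x y"
    by (auto simp: linear_isometry_on_def)
qed

lemma norm_Pi1: "g \<in> carrier (sym_group n) \<Longrightarrow> norm (Pi1 g x) = norm x"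
proof -
  assume "g \<in> carrier (sym_group n)"
  then have "complex_of_real ((norm (Pi1 g x))\<^sup>2) = complex_of_real ((norm x)\<^sup>2)"
    unfolding cinner_norm[symmetric] by (rule Pi1_isometry)
  then have "(norm (Pi1 g x))\<^sup>2 = (norm x)\<^sup>2"
    using of_real_eq_iff by blast
  then show ?thesis
    by (simp add: power2_eq_iff_nonneg)
qed

lemma Pi1_zero: "g \<in> carrier (sym_group n) \<Longrightarrow> Pi1 g 0 = 0"
  using Pi1_isometry(2)[of g n 0 0] by simp

lemma Pi1_sum: "g \<in> carrier (sym_group n) \<Longrightarrow> Pi1 g (\<Sum>i\<in>I. f i) = (\<Sum>i\<in>I. Pi1 g (f i))"
  by (induction I rule: infinite_finite_induct) (auto simp: Pi1_isometry Pi1_zero)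

lemma Pi1_diff: "g \<in> carrier (sym_group n) \<Longrightarrow> Pi1 g (x - y) = Pi1 g x - Pi1 g y"
  using Pi1_isometry(1)[of g n "x - y" y] by simp

lemma Pi1_id: "Pi1 id x = x"
  using unitary by (auto simp: unitary_rep_def sym_group_inf_def)

lemma J_add: "v \<in> tableau_space (two_row j) \<Longrightarrow> w \<in> tableau_space (two_row j) \<Longrightarrow> J j (v + w) = J j v + J j w"
  and J_scale: "v \<in> tableau_space (two_row j) \<Longrightarrow> J j (vec_scale c v) = scaleC c (J j v)"
  and cinner_J: "v \<in> tableau_space (two_row j) \<Longrightarrow> w \<in> tableau_space (two_row j) \<Longrightarrow>
    cinner (J j v) (J j w) = vec_inner v w"
  and J_embedding: "v \<in> tableau_space (two_row j) \<Longrightarrow> J (j + 1) (stationary_embedding p q j v) = J j v"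
  and dense: "closure (\<Union>j. J j ` tableau_space (two_row j)) = UNIV"
  using limit unfolding inductive_limit_completion_def linear_isometry_on_def by blast+

lemma J_single: "t \<in> standard_tableaux (two_row j) \<Longrightarrow> J j (Poly_Mapping.single t c) = scaleC c (basis_vec j t)"
  using J_scale[OF single_in_tableau_space, of t j c 1] by (simp add: vec_scale_single basis_vec_def)

lemma J_zero: "J j 0 = 0"
  using J_scale[of 0 j 0] vec_scale_single[of 0 _ 0] by (simp add: tableau_space_def)

lemma J_sum:
  "(\<And>i. i \<in> I \<Longrightarrow> f i \<in> tableau_space (two_row j)) \<Longrightarrow> J j (\<Sum>i\<in>I. f i) = (\<Sum>i\<in>I. J j (f i))"
  by (induction I rule: infinite_finite_induct) (auto simp: J_zero J_add tableau_space_sum)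

lemma J_eq_sum_basis:
  assumes "v \<in> tableau_space (two_row j)"
  shows "J j v = (\<Sum>t\<in>Poly_Mapping.keys v. scaleC (Poly_Mapping.lookup v t) (basis_vec j t))"
proof -
  have std: "t \<in> standard_tableaux (two_row j)" if "t \<in> Poly_Mapping.keys v" for t
    using assms that by (auto simp: tableau_space_def)
  have "J j v = J j (\<Sum>t\<in>Poly_Mapping.keys v. Poly_Mapping.single t (Poly_Mapping.lookup v t))"
    by (subst tableau_vec_eq_sum_single) simp
  also have "\<dots> = (\<Sum>t\<in>Poly_Mapping.keys v. J j (Poly_Mapping.single t (Poly_Mapping.lookup v t)))"
    using std by (intro J_sum single_in_tableau_space)
  finally show ?thesis
    using std by (simp add: J_single)
qed

lemma basis_orthonormal:
  "t \<in> standard_tableaux (two_row j) \<Longrightarrow> s \<in> standard_tableaux (two_row j) \<Longrightarrow>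
    cinner (basis_vec j t) (basis_vec j s) = (if t = s then 1 else 0)"
  by (simp add: basis_vec_def cinner_J single_in_tableau_space vec_inner_single)

lemma basis_vec_embedding:
  assumes "t \<in> standard_tableaux (two_row j)"
  shows "basis_vec j t =
    scaleC p (basis_vec (j + 1) (append_21 j t)) + scaleC q (basis_vec (j + 1) (append_12 j t))"
proof -
  have "stationary_embedding p q j (Poly_Mapping.single t 1) =
      vec_scale 1 (Poly_Mapping.single (append_21 j t) (complex_of_real p) +
        Poly_Mapping.single (append_12 j t) (complex_of_real q))"
    by (simp add: stationary_embedding_def)
  also have "\<dots> = Poly_Mapping.single (append_21 j t) (complex_of_real p) +
        Poly_Mapping.single (append_12 j t) (complex_of_real q)"
    by (rule poly_mapping_eqI) (simp add: vec_scale_def Poly_Mapping.map.rep_eq when_def)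
  finally show ?thesis
    using J_embedding[OF single_in_tableau_space[OF assms], of 1] append_standard[OF assms]
    by (simp add: basis_vec_def[of j] J_add J_single single_in_tableau_space)
qed

lemma stationary_embedding_in_space:
  assumes "v \<in> tableau_space (two_row j)"
  shows "stationary_embedding p q j v \<in> tableau_space (two_row (j + 1))"
  unfolding stationary_embedding_def
proof (rule tableau_space_sum)
  fix t
  assume "t \<in> Poly_Mapping.keys v"
  then have t: "t \<in> standard_tableaux (two_row j)"
    using assms by (auto simp: tableau_space_def)
  define w where "w = Poly_Mapping.single (append_21 j t) (complex_of_real p) +
    Poly_Mapping.single (append_12 j t) (complex_of_real q)"
  have "w \<in> tableau_space (two_row (j + 1))"
    unfolding w_def by (intro tableau_space_add single_in_tableau_space append_standard t)
  moreover have "Poly_Mapping.keys (vec_scale c w) \<subseteq> Poly_Mapping.keys w" for c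
    by (auto simp: vec_scale_def in_keys_iff Poly_Mapping.map.rep_eq when_def)
  ultimately have "vec_scale c w \<in> tableau_space (two_row (j + 1))" for c
    by (auto simp: tableau_space_def)
  then show "vec_scale (Poly_Mapping.lookup v t) (Poly_Mapping.single (append_21 j t) (complex_of_real p) +
      Poly_Mapping.single (append_12 j t) (complex_of_real q)) \<in> tableau_space (two_row (j + 1))"
    by (simp only: w_def)
qed

lemma range_J_mono:
  assumes "i \<le> j"
  shows "J i ` tableau_space (two_row i) \<subseteq> J j ` tableau_space (two_row j)"
  using assms
proof (induction j rule: dec_induct)
  case (step j)
  have "J j ` tableau_space (two_row j) \<subseteq> J (j + 1) ` tableau_space (two_row (j + 1))"
    using J_embedding stationary_embedding_in_space by (metis image_eqI image_subsetI)
  with step show ?case by simp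
qed simp

text \<open>
  By sesquilinearity the compression of \<open>Pi1 g\<close> to a stage is a scalar as soon as its matrix in the
  tableau basis is.
\<close>

lemma compression_scalar_from_basis:
  assumes g: "g \<in> carrier (sym_group n)"
    and basis: "\<And>t s. t \<in> standard_tableaux (two_row j) \<Longrightarrow> s \<in> standard_tableaux (two_row j) \<Longrightarrow>
      cinner (Pi1 g (basis_vec j t)) (basis_vec j s) = (if t = s then \<alpha> else 0)"
    and x: "x \<in> J j ` tableau_space (two_row j)" and y: "y \<in> J j ` tableau_space (two_row j)"
  shows "cinner (Pi1 g x) y = \<alpha> * cinner x y"
proof -
  obtain v w where v: "v \<in> tableau_space (two_row j)" "x = J j v"
    and w: "w \<in> tableau_space (two_row j)" "y = J j w"
    using x y by auto
  have std: "t \<in> standard_tableaux (two_row j)" if "t \<in> Poly_Mapping.keys v \<union> Poly_Mapping.keys w" for t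
    using that v w by (auto simp: tableau_space_def)
  have "cinner (Pi1 g (basis_vec j t)) (basis_vec j s) = \<alpha> * cinner (basis_vec j t) (basis_vec j s)"
    if "t \<in> Poly_Mapping.keys v" "s \<in> Poly_Mapping.keys w" for t s
    using that std by (simp add: basis basis_orthonormal)
  then show ?thesis
    unfolding v(2) w(2) J_eq_sum_basis[OF v(1)] J_eq_sum_basis[OF w(1)]
    by (simp add: Pi1_sum[OF g] Pi1_isometry[OF g] cinner_sum_left cinner_sum_right
        cinner_scaleC_left cinner_scaleC_right sum_distrib_left mult_ac)
qed


section \<open>Matrix elements of the Coxeter generators\<close>

lemma young_action:
  assumes "t \<in> standard_tableaux (two_row j)" "1 \<le> k" "k < 2 * j + 1"
    and d: "d = axial_distance (two_row j) t k"
  shows "\<pi> j (Transposition.transpose k (k + 1)) (Poly_Mapping.single t 1) =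
      Poly_Mapping.single t (complex_of_real (1 / of_int d)) +
      Poly_Mapping.single (Transposition.transpose k (k + 1) \<circ> t) (complex_of_real (sqrt (1 - 1 / (of_int d)\<^sup>2)))"
    and "Pi1 (Transposition.transpose k (k + 1)) (basis_vec j t) =
      J j (\<pi> j (Transposition.transpose k (k + 1)) (Poly_Mapping.single t 1))"
proof -
  show "\<pi> j (Transposition.transpose k (k + 1)) (Poly_Mapping.single t 1) =
      Poly_Mapping.single t (complex_of_real (1 / of_int d)) +
      Poly_Mapping.single (Transposition.transpose k (k + 1) \<circ> t) (complex_of_real (sqrt (1 - 1 / (of_int d)\<^sup>2)))"
    using assms young[of j] unfolding young_orthogonal_rep_def Let_def by (simp add: sum_list_two_row)
  show "Pi1 (Transposition.transpose k (k + 1)) (basis_vec j t) =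
      J j (\<pi> j (Transposition.transpose k (k + 1)) (Poly_Mapping.single t 1))"
    unfolding basis_vec_def using assms
    by (intro intertwines[OF transpose_in_sym_group single_in_tableau_space]) auto
qed

text \<open>
  At axial distance \<open>1\<close> or \<open>-1\<close> the entries are neighbours in a row or a column. The swapped tableau
  is then not standard, and \<open>J j\<close> says nothing about it, but its coefficient \<open>\<surd>(1 - 1 / d\<^sup>2)\<close> is 0.
\<close>

lemma young_action_adjacent:
  assumes "t \<in> standard_tableaux (two_row j)" "1 \<le> k" "k < 2 * j + 1"
    and "axial_distance (two_row j) t k = d" "\<bar>d\<bar> = 1"
  shows "Pi1 (Transposition.transpose k (k + 1)) (basis_vec j t) = scaleC (of_int d) (basis_vec j t)"
proof -
  have "d = 1 \<or> d = -1"
    using assms(5) by linarith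
  then show ?thesis
    using young_action[OF assms(1-3) assms(4)[symmetric]] assms(1) by (auto simp: J_single)
qed

text \<open>
  The swapped tableau is standard because the representation preserves the tableau space: it occurs
  with a nonzero coefficient in the image of \<open>t\<close>.
\<close>

lemma young_action_swap:
  assumes t: "t \<in> standard_tableaux (two_row j)" and k: "1 \<le> k" "k < 2 * j + 1"
    and d: "axial_distance (two_row j) t k = d" "\<bar>d\<bar> > 1"
  shows "Transposition.transpose k (k + 1) \<circ> t \<in> standard_tableaux (two_row j)"
    and "Pi1 (Transposition.transpose k (k + 1)) (basis_vec j t) =
      scaleC (1 / of_int d) (basis_vec j t) +
      scaleC (sqrt (1 - 1 / (of_int d)\<^sup>2)) (basis_vec j (Transposition.transpose k (k + 1) \<circ> t))"
proof -
  define g where "g = Transposition.transpose k (k + 1)"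
  have g: "g \<in> carrier (sym_group (sum_list (two_row j)))"
    unfolding g_def using k by (intro transpose_in_sym_group) (auto simp: sum_list_two_row)
  have img: "\<pi> j g (Poly_Mapping.single t 1) \<in> tableau_space (two_row j)"
    using young[of j] g single_in_tableau_space[OF t, of 1]
    unfolding young_orthogonal_rep_def unitary_rep_def by blast
  have "1 < (real_of_int \<bar>d\<bar>)\<^sup>2"
    using d(2) by (intro one_less_power) auto
  then have "1 - 1 / (real_of_int d)\<^sup>2 > 0"
    by (simp add: divide_simps)
  then have c: "sqrt (1 - 1 / (real_of_int d)\<^sup>2) \<noteq> 0"
    by (simp only: real_sqrt_eq_zero_cancel_iff)
  have "g \<circ> t \<noteq> t"
  proof -
    have "k \<in> t ` cells (two_row j)"
      using t k by (auto simp: standard_tableaux_def bij_betw_def sum_list_two_row)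
    then obtain x where "t x = k" by auto
    then have "(g \<circ> t) x \<noteq> t x"
      by (simp add: g_def)
    then show ?thesis by metis
  qed
  then have "Poly_Mapping.lookup (\<pi> j g (Poly_Mapping.single t 1)) (g \<circ> t) \<noteq> 0"
    using young_action(1)[OF t k d(1)[symmetric]] c
    by (simp add: g_def lookup_add lookup_single when_def)
  then have "g \<circ> t \<in> standard_tableaux (two_row j)"
    using img by (auto simp: tableau_space_def in_keys_iff)
  then show std: "Transposition.transpose k (k + 1) \<circ> t \<in> standard_tableaux (two_row j)"
    by (simp only: g_def)
  show "Pi1 (Transposition.transpose k (k + 1)) (basis_vec j t) =
      scaleC (1 / of_int d) (basis_vec j t) +
      scaleC (sqrt (1 - 1 / (of_int d)\<^sup>2)) (basis_vec j (Transposition.transpose k (k + 1) \<circ> t))"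
    unfolding young_action(2)[OF t k d(1)[symmetric]] young_action(1)[OF t k d(1)[symmetric]]
    using t std by (simp add: J_add J_single single_in_tableau_space)
qed


text \<open>
  The expectation of the matrix with rows \<open>(1/2, \<surd>3/2)\<close> and \<open>(\<surd>3/2, -1/2)\<close> in the vector \<open>(p, q)\<close>.
\<close>

definition even_value :: real
  where "even_value = (p\<^sup>2 - q\<^sup>2) / 2 + sqrt 3 * p * q"

text \<open>
  The two entries of one step lie in different rows, at axial distance \<open>2\<close> or \<open>-2\<close>, and their swap
  exchanges the two orders.
\<close>

lemma Pi1_within_step:
  assumes t: "t \<in> standard_tableaux (two_row j)"
  defines "g \<equiv> Transposition.transpose (2 * j + 2) (2 * j + 3)"
  shows "Pi1 g (basis_vec (j + 1) (append_21 j t)) =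
      scaleC (1 / 2) (basis_vec (j + 1) (append_21 j t)) + scaleC (sqrt 3 / 2) (basis_vec (j + 1) (append_12 j t))"
    and "Pi1 g (basis_vec (j + 1) (append_12 j t)) =
      scaleC (- 1 / 2) (basis_vec (j + 1) (append_12 j t)) + scaleC (sqrt 3 / 2) (basis_vec (j + 1) (append_21 j t))"
proof -
  have root: "sqrt (3 / 4) = sqrt 3 / 2"
    by (simp add: real_sqrt_divide)
  have "2 * j + 2 + 1 = 2 * j + 3"
    by simp
  then have g: "Transposition.transpose (2 * j + 2) (2 * j + 2 + 1) = g"
    by (simp only: g_def)
  have "axial_distance (two_row (j + 1)) (append_21 j t) (2 * j + 2) = (int (j + 1) - int 0) - (int j - int 1)"
    by (rule axial_distance_eq[OF append_standard(1)[OF t]]) (auto simp: cells_two_row)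
  then have d: "axial_distance (two_row (j + 1)) (append_21 j t) (2 * j + 2) = 2"
    by simp
  show "Pi1 g (basis_vec (j + 1) (append_21 j t)) =
      scaleC (1 / 2) (basis_vec (j + 1) (append_21 j t)) + scaleC (sqrt 3 / 2) (basis_vec (j + 1) (append_12 j t))"
    using young_action_swap(2)[OF append_standard(1)[OF t] _ _ d, unfolded g] transpose_append(1)[OF t, folded g_def]
    by (simp add: root)
  have "axial_distance (two_row (j + 1)) (append_12 j t) (2 * j + 2) = (int j - int 1) - (int (j + 1) - int 0)"
    by (rule axial_distance_eq[OF append_standard(2)[OF t]]) (auto simp: cells_two_row)
  then have d: "axial_distance (two_row (j + 1)) (append_12 j t) (2 * j + 2) = -2"
    by simp
  show "Pi1 g (basis_vec (j + 1) (append_12 j t)) =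
      scaleC (- 1 / 2) (basis_vec (j + 1) (append_12 j t)) + scaleC (sqrt 3 / 2) (basis_vec (j + 1) (append_21 j t))"
    using young_action_swap(2)[OF append_standard(2)[OF t] _ _ d, unfolded g] transpose_append(2)[OF t, folded g_def]
    by (simp add: root)
qed

lemma cinner_even_generator:
  assumes x: "x \<in> J j ` tableau_space (two_row j)" and y: "y \<in> J j ` tableau_space (two_row j)"
  shows "cinner (Pi1 (Transposition.transpose (2 * j + 2) (2 * j + 3)) x) y = even_value * cinner x y"
proof -
  define g where "g = Transposition.transpose (2 * j + 2) (2 * j + 3)"
  have g: "g \<in> carrier (sym_group (2 * j + 3))"
    unfolding g_def by (intro transpose_in_sym_group) auto
  have "cinner (Pi1 g (basis_vec j t)) (basis_vec j s) = (if t = s then even_value else 0)"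
    if t: "t \<in> standard_tableaux (two_row j)" and s: "s \<in> standard_tableaux (two_row j)" for t s
    unfolding basis_vec_embedding[OF t] basis_vec_embedding[OF s]
    by (simp only: Pi1_isometry[OF g] Pi1_within_step[OF t, folded g_def]
        cinner_add_left cinner_add_right cinner_scaleC_left cinner_scaleC_right
        basis_orthonormal append_standard[OF t] append_standard[OF s] append_inject[OF t s]
        append_distinct if_False simp_thms)
      (simp add: even_value_def power2_eq_square field_simps)
  then show ?thesis
    using compression_scalar_from_basis[OF g _ x y] by (simp add: g_def)
qed

text \<open>
  The mean of the diagonal entries \<open>-1, 1, 1, 1/3\<close> for the four pairs of orders, weighted by the
  probabilities \<open>p\<^sup>4, p\<^sup>2q\<^sup>2, p\<^sup>2q\<^sup>2, q\<^sup>4\<close> of the pairs.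
\<close>

definition odd_value :: real
  where "odd_value = 2 * p\<^sup>2 * q\<^sup>2 - p ^ 4 + q ^ 4 / 3"

text \<open>
  The last entry of a step and the first entry of the next are adjacent, in one column or one row,
  unless both steps use the order 12; then the axial distance is \<open>3\<close>, and the swapped tableau \<open>u\<close>
  fills the first row twice before the second. The value of \<open>u\<close> at \<open>(1, j)\<close> tells it apart from all
  tableaux that arise from two steps.
\<close>

lemma Pi1_between_steps:
  assumes t: "t \<in> standard_tableaux (two_row j)"
  defines "g \<equiv> Transposition.transpose (2 * j + 3) (2 * j + 4)"
  shows "Pi1 g (basis_vec (j + 2) (append_21 (j + 1) (append_21 j t))) =
      scaleC (- 1) (basis_vec (j + 2) (append_21 (j + 1) (append_21 j t)))"
    and "Pi1 g (basis_vec (j + 2) (append_12 (j + 1) (append_21 j t))) =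
      basis_vec (j + 2) (append_12 (j + 1) (append_21 j t))"
    and "Pi1 g (basis_vec (j + 2) (append_21 (j + 1) (append_12 j t))) =
      basis_vec (j + 2) (append_21 (j + 1) (append_12 j t))"
    and "\<exists>u\<in>standard_tableaux (two_row (j + 2)). u (1, j) = 2 * j + 4 \<and>
      Pi1 g (basis_vec (j + 2) (append_12 (j + 1) (append_12 j t))) =
      scaleC (1 / 3) (basis_vec (j + 2) (append_12 (j + 1) (append_12 j t))) +
      scaleC (sqrt (8 / 9)) (basis_vec (j + 2) u)"
proof -
  have "2 * j + 3 + 1 = 2 * j + 4"
    by simp
  then have g: "Transposition.transpose (2 * j + 3) (2 * j + 3 + 1) = g"
    by (simp only: g_def)
  have std: "append_21 (j + 1) (append_21 j t) \<in> standard_tableaux (two_row (j + 2))"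
    "append_12 (j + 1) (append_21 j t) \<in> standard_tableaux (two_row (j + 2))"
    "append_21 (j + 1) (append_12 j t) \<in> standard_tableaux (two_row (j + 2))"
    "append_12 (j + 1) (append_12 j t) \<in> standard_tableaux (two_row (j + 2))"
    using append_standard[OF append_standard(1)[OF t]] append_standard[OF append_standard(2)[OF t]] by simp_all
  note simps = cells_two_row append_21_def append_12_def
  have "axial_distance (two_row (j + 2)) (append_21 (j + 1) (append_21 j t)) (2 * j + 3) =
      (int (j + 1) - int 1) - (int (j + 1) - int 0)"
    by (rule axial_distance_eq[OF std(1)]) (auto simp: simps)
  then show "Pi1 g (basis_vec (j + 2) (append_21 (j + 1) (append_21 j t))) =
      scaleC (- 1) (basis_vec (j + 2) (append_21 (j + 1) (append_21 j t)))"
    using young_action_adjacent[OF std(1), of "2 * j + 3" "-1", unfolded g] by simp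
  have "axial_distance (two_row (j + 2)) (append_12 (j + 1) (append_21 j t)) (2 * j + 3) =
      (int (j + 2) - int 0) - (int (j + 1) - int 0)"
    by (rule axial_distance_eq[OF std(2)]) (auto simp: simps)
  then show "Pi1 g (basis_vec (j + 2) (append_12 (j + 1) (append_21 j t))) =
      basis_vec (j + 2) (append_12 (j + 1) (append_21 j t))"
    using young_action_adjacent[OF std(2), of "2 * j + 3" 1, unfolded g] by simp
  have "axial_distance (two_row (j + 2)) (append_21 (j + 1) (append_12 j t)) (2 * j + 3) =
      (int (j + 1) - int 1) - (int j - int 1)"
    by (rule axial_distance_eq[OF std(3)]) (auto simp: simps)
  then show "Pi1 g (basis_vec (j + 2) (append_21 (j + 1) (append_12 j t))) =
      basis_vec (j + 2) (append_21 (j + 1) (append_12 j t))"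
    using young_action_adjacent[OF std(3), of "2 * j + 3" 1, unfolded g] by simp
  have "axial_distance (two_row (j + 2)) (append_12 (j + 1) (append_12 j t)) (2 * j + 3) =
      (int (j + 2) - int 0) - (int j - int 1)"
    by (rule axial_distance_eq[OF std(4)]) (auto simp: simps)
  then have d: "axial_distance (two_row (j + 2)) (append_12 (j + 1) (append_12 j t)) (2 * j + 3) = 3"
    by simp
  define u where "u = g \<circ> append_12 (j + 1) (append_12 j t)"
  have "u (1, j) = 2 * j + 4"
    by (simp add: u_def g_def append_12_def)
  moreover have "u \<in> standard_tableaux (two_row (j + 2))"
    using young_action_swap(1)[OF std(4) _ _ d, unfolded g] by (simp add: u_def)
  moreover have "Pi1 g (basis_vec (j + 2) (append_12 (j + 1) (append_12 j t))) =
      scaleC (1 / 3) (basis_vec (j + 2) (append_12 (j + 1) (append_12 j t))) +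
      scaleC (sqrt (8 / 9)) (basis_vec (j + 2) u)"
    using young_action_swap(2)[OF std(4) _ _ d, unfolded g] by (simp add: u_def)
  ultimately show "\<exists>u\<in>standard_tableaux (two_row (j + 2)). u (1, j) = 2 * j + 4 \<and>
      Pi1 g (basis_vec (j + 2) (append_12 (j + 1) (append_12 j t))) =
      scaleC (1 / 3) (basis_vec (j + 2) (append_12 (j + 1) (append_12 j t))) +
      scaleC (sqrt (8 / 9)) (basis_vec (j + 2) u)"
    by blast
qed

lemma basis_vec_embedding_two:
  assumes t: "t \<in> standard_tableaux (two_row j)"
  shows "basis_vec j t =
    scaleC (p\<^sup>2) (basis_vec (j + 2) (append_21 (j + 1) (append_21 j t))) +
    scaleC (p * q) (basis_vec (j + 2) (append_12 (j + 1) (append_21 j t))) +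
    scaleC (p * q) (basis_vec (j + 2) (append_21 (j + 1) (append_12 j t))) +
    scaleC (q\<^sup>2) (basis_vec (j + 2) (append_12 (j + 1) (append_12 j t)))"
  unfolding basis_vec_embedding[OF t] basis_vec_embedding[OF append_standard(1)[OF t]]
    basis_vec_embedding[OF append_standard(2)[OF t]]
  by (simp add: scaleC_add_right scaleC_scaleC power2_eq_square mult.commute add_ac)

lemma cinner_odd_generator:
  assumes x: "x \<in> J j ` tableau_space (two_row j)" and y: "y \<in> J j ` tableau_space (two_row j)"
  shows "cinner (Pi1 (Transposition.transpose (2 * j + 3) (2 * j + 4)) x) y = odd_value * cinner x y"
proof -
  define g where "g = Transposition.transpose (2 * j + 3) (2 * j + 4)"
  have g: "g \<in> carrier (sym_group (2 * j + 4))"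
    unfolding g_def by (intro transpose_in_sym_group) auto
  have "cinner (Pi1 g (basis_vec j t)) (basis_vec j s) = (if t = s then odd_value else 0)"
    if t: "t \<in> standard_tableaux (two_row j)" and s: "s \<in> standard_tableaux (two_row j)" for t s
  proof -
    obtain u where u: "u \<in> standard_tableaux (two_row (j + 2))" "u (1, j) = 2 * j + 4"
      and act: "Pi1 g (basis_vec (j + 2) (append_12 (j + 1) (append_12 j t))) =
        scaleC (1 / 3) (basis_vec (j + 2) (append_12 (j + 1) (append_12 j t))) +
        scaleC (sqrt (8 / 9)) (basis_vec (j + 2) u)"
      using Pi1_between_steps(4)[OF t, folded g_def] by blast
    have std: "append_21 (j + 1) (append_21 j r) \<in> standard_tableaux (two_row (j + 2))"
      "append_12 (j + 1) (append_21 j r) \<in> standard_tableaux (two_row (j + 2))"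
      "append_21 (j + 1) (append_12 j r) \<in> standard_tableaux (two_row (j + 2))"
      "append_12 (j + 1) (append_12 j r) \<in> standard_tableaux (two_row (j + 2))"
      if "r \<in> standard_tableaux (two_row j)" for r
      using append_standard[OF append_standard(1)[OF that]] append_standard[OF append_standard(2)[OF that]]
      by simp_all
    \<comment> \<open>Two steps put \<open>2 * j + 2\<close> or \<open>2 * j + 3\<close> into the cell \<open>(1, j)\<close>, so \<open>u\<close> is orthogonal to them.\<close>
    have "append_21 (j + 1) (append_21 j s) (1, j) \<noteq> u (1, j)"
      "append_12 (j + 1) (append_21 j s) (1, j) \<noteq> u (1, j)"
      "append_21 (j + 1) (append_12 j s) (1, j) \<noteq> u (1, j)"
      "append_12 (j + 1) (append_12 j s) (1, j) \<noteq> u (1, j)"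
      using u(2) by (simp_all add: append_21_def append_12_def)
    then have ne: "u \<noteq> append_21 (j + 1) (append_21 j s)"
      "u \<noteq> append_12 (j + 1) (append_21 j s)"
      "u \<noteq> append_21 (j + 1) (append_12 j s)"
      "u \<noteq> append_12 (j + 1) (append_12 j s)"
      by auto
    note inj = append_inject[OF append_standard(1)[OF t] append_standard(1)[OF s]]
      append_inject[OF append_standard(1)[OF t] append_standard(2)[OF s]]
      append_inject[OF append_standard(2)[OF t] append_standard(1)[OF s]]
      append_inject[OF append_standard(2)[OF t] append_standard(2)[OF s]]
      append_inject[OF t s] append_distinct
    show ?thesis
      unfolding basis_vec_embedding_two[OF t] basis_vec_embedding_two[OF s]
      by (simp only: Pi1_isometry[OF g] Pi1_between_steps(1-3)[OF t, folded g_def] act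
          cinner_add_left cinner_add_right cinner_scaleC_left cinner_scaleC_right
          basis_orthonormal std[OF t] std[OF s] u(1) ne inj if_False simp_thms)
        (simp add: odd_value_def power2_eq_square power4_eq_xxxx algebra_simps)
  qed
  then show ?thesis
    using compression_scalar_from_basis[OF g _ x y] by (simp add: g_def)
qed


section \<open>The Coxeter--Laplace operator\<close>

lemma extend_rep_coxeter_laplace:
  "extend_rep Pi1 (coxeter_laplace N) x = scaleC (of_nat N) x - (\<Sum>k=1..N. Pi1 (coxeter N k) x)"
  by (simp add: coxeter_laplace_def extend_rep_diff extend_rep_sum extend_rep_single Pi1_id)

definition mean_laplace :: "nat \<Rightarrow> 'h \<Rightarrow> 'h"
  where "mean_laplace N x = scaleC (1 / of_nat N) (extend_rep Pi1 (coxeter_laplace N) x)"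

lemma mean_laplace_diff: "mean_laplace N (x - y) = mean_laplace N x - mean_laplace N y"
proof -
  have sc: "scaleC c (x - y) = scaleC c x - scaleC c y" for c and x y :: 'h
    using scaleC_add_right[of c "x - y" y] by simp
  have "(\<Sum>k=1..N. Pi1 (coxeter N k) (x - y)) = (\<Sum>k=1..N. Pi1 (coxeter N k) x) - (\<Sum>k=1..N. Pi1 (coxeter N k) y)"
    unfolding sum_subtractf[symmetric]
    by (intro sum.cong refl Pi1_diff[OF coxeter_in_sym_group]) auto
  then show ?thesis
    by (simp add: mean_laplace_def extend_rep_coxeter_laplace sc)
qed

lemma norm_mean_laplace: "norm (mean_laplace N x) \<le> 2 * norm x"
proof (cases "N = 0")
  case False
  have "norm (extend_rep Pi1 (coxeter_laplace N) x) \<le> real N * norm x + (\<Sum>k=1..N. norm x)"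
    unfolding extend_rep_coxeter_laplace
    by (intro order_trans[OF norm_triangle_ineq4] add_mono order_trans[OF norm_sum] sum_mono)
      (auto simp: norm_scaleC norm_Pi1[OF coxeter_in_sym_group])
  then show ?thesis
    using False by (simp add: mean_laplace_def norm_scaleC norm_divide field_simps)
qed (simp add: mean_laplace_def)

text \<open>
  Two vectors of possibly different stages lie in a common stage, and in all later ones; hence the
  matrix elements of all but finitely many generators are known exactly.
\<close>

lemma mean_laplace_limit_on_stages:
  assumes x: "x \<in> (\<Union>j. J j ` tableau_space (two_row j))" and y: "y \<in> (\<Union>j. J j ` tableau_space (two_row j))"
  shows "(\<lambda>N. cinner (mean_laplace N x) y) \<longlonglongrightarrow> (1 - (even_value + odd_value) / 2) * cinner x y"
proof -
  obtain i i' where "x \<in> J i ` tableau_space (two_row i)" "y \<in> J i' ` tableau_space (two_row i')"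
    using x y by auto
  then have xy: "x \<in> J j ` tableau_space (two_row j)" "y \<in> J j ` tableau_space (two_row j)"
    if "j \<ge> i + i'" for j
    using that range_J_mono[of i j] range_J_mono[of i' j] by auto
  define c where "c = cinner x y"
  define a where "a = (\<lambda>k. cinner (Pi1 (Transposition.transpose k (k + 1)) x) y)"
  \<comment> \<open>Stage \<open>j - 1\<close> controls the generators \<open>2 * j\<close> and \<open>2 * j + 1\<close>.\<close>
  have "a (2 * j) = even_value * c" "a (2 * j + 1) = odd_value * c" if "j \<ge> i + i' + 1" for j
  proof -
    have k: "2 * (j - 1) + 2 = 2 * j" "2 * (j - 1) + 3 = 2 * j + 1" "2 * (j - 1) + 4 = 2 * j + 1 + 1"
      using that by auto
    show "a (2 * j) = even_value * c" "a (2 * j + 1) = odd_value * c"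
      using that cinner_even_generator[OF xy[of "j - 1"], unfolded k]
        cinner_odd_generator[OF xy[of "j - 1"], unfolded k]
      by (simp_all add: a_def c_def)
  qed
  then have lim: "(\<lambda>N. (\<Sum>k=1..<N. a k) / of_nat N) \<longlonglongrightarrow> (even_value * c + odd_value * c) / 2"
    by (intro cesaro_eventually_two_periodic[of "i + i' + 1"])
  \<comment> \<open>The index \<open>0\<close> needs its own summand: \<open>coxeter 0 0\<close> moves \<open>0\<close> and lies in no symmetric group.\<close>
  have "Bseq (\<lambda>N. cinner (Pi1 (coxeter N N) x) y)"
  proof (rule BseqI')
    fix N
    show "norm (cinner (Pi1 (coxeter N N) x) y) \<le> norm (Pi1 (coxeter 0 0) x) * norm y + norm x * norm y"
    proof (cases "N = 0")
      case False
      then have "norm (Pi1 (coxeter N N) x) = norm x"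
        by (intro norm_Pi1[of _ N] coxeter_in_sym_group) auto
      then show ?thesis
        using cinner_Cauchy_Schwarz[of "Pi1 (coxeter N N) x" y] by (simp add: add_increasing)
    qed (use cinner_Cauchy_Schwarz[of "Pi1 (coxeter 0 0) x" y] in \<open>simp add: add_increasing2\<close>)
  qed
  then have lim': "(\<lambda>N. cinner (Pi1 (coxeter N N) x) y / of_nat N) \<longlonglongrightarrow> 0"
    unfolding divide_inverse
    using bounded_bilinear.Bfun_prod_Zfun[OF bounded_bilinear_mult, of _ sequentially "\<lambda>N. inverse (of_nat N)"]
      lim_inverse_n by (simp add: tendsto_Zfun_iff)
  have "(\<lambda>N. c - (\<Sum>k=1..<N. a k) / of_nat N - cinner (Pi1 (coxeter N N) x) y / of_nat N)
      \<longlonglongrightarrow> c - (even_value * c + odd_value * c) / 2 - 0"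
    by (intro tendsto_intros lim lim')
  moreover have "\<forall>\<^sub>F N in sequentially.
      c - (\<Sum>k=1..<N. a k) / of_nat N - cinner (Pi1 (coxeter N N) x) y / of_nat N = cinner (mean_laplace N x) y"
    using eventually_ge_at_top[of 1]
  proof eventually_elim
    case (elim N)
    have "{1..N} = insert N {1..<N}"
      using elim by auto
    then have "(\<Sum>k=1..N. cinner (Pi1 (coxeter N k) x) y) =
        cinner (Pi1 (coxeter N N) x) y + (\<Sum>k=1..<N. cinner (Pi1 (coxeter N k) x) y)"
      by simp
    also have "(\<Sum>k=1..<N. cinner (Pi1 (coxeter N k) x) y) = (\<Sum>k=1..<N. a k)"
      by (intro sum.cong) (auto simp: a_def coxeter_def)
    finally show ?case
      using elim
      by (simp add: mean_laplace_def extend_rep_coxeter_laplace cinner_scaleC_left cinner_diff_left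
          cinner_sum_left c_def[symmetric] diff_divide_distrib add_divide_distrib)
  qed
  ultimately have "(\<lambda>N. cinner (mean_laplace N x) y) \<longlonglongrightarrow> c - (even_value * c + odd_value * c) / 2 - 0"
    by (simp add: tendsto_cong)
  then show ?thesis
    by (simp add: c_def field_simps)
qed

text \<open>
  The deviation \<open>B N\<close> from the limit is a sesquilinear form bounded uniformly in \<open>N\<close>, so the density
  argument applies to the second variable and then to the first.
\<close>

lemma mean_laplace_weak_limit:
  "(\<lambda>N. cinner (mean_laplace N x) y) \<longlonglongrightarrow> (1 - (even_value + odd_value) / 2) * cinner x y"
proof -
  define \<kappa> where "\<kappa> = complex_of_real (1 - (even_value + odd_value) / 2)"
  define B where "B = (\<lambda>N x y. cinner (mean_laplace N x) y - \<kappa> * cinner x y)"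
  define D where "D = (\<Union>j. J j ` tableau_space (two_row j))"
  have bound: "norm (B N x y) \<le> (2 + norm \<kappa>) * norm x * norm y" for N x y
  proof -
    have "norm (B N x y) \<le> norm (mean_laplace N x) * norm y + norm \<kappa> * (norm x * norm y)"
      unfolding B_def
      by (intro order_trans[OF norm_triangle_ineq4] add_mono cinner_Cauchy_Schwarz)
        (auto simp: norm_mult intro!: mult_left_mono cinner_Cauchy_Schwarz)
    also have "\<dots> \<le> 2 * norm x * norm y + norm \<kappa> * (norm x * norm y)"
      by (intro add_mono mult_right_mono norm_mean_laplace) auto
    finally show ?thesis
      by (simp add: algebra_simps)
  qed
  have diff: "B N x y - B N x' y = B N (x - x') y" "B N x y - B N x y' = B N x (y - y')" for N x x' y y'
    by (simp_all add: B_def mean_laplace_diff cinner_diff_left cinner_diff_right algebra_simps)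
  have stage: "(\<lambda>N. B N x y) \<longlonglongrightarrow> 0" if "x \<in> D" "y \<in> D" for x y
    using mean_laplace_limit_on_stages that unfolding B_def D_def \<kappa>_def by (simp add: LIM_zero)
  have right: "(\<lambda>N. B N x y) \<longlonglongrightarrow> 0" if "x \<in> D" for x y
  proof (rule tendsto_zero_from_dense[where f = "\<lambda>N. B N x"])
    show "norm (B N x y - B N x y') \<le> (2 + norm \<kappa>) * norm x * norm (y - y')" for N y y'
      unfolding diff by (rule bound)
    show "closure D = UNIV"
      unfolding D_def by (rule dense)
  qed (rule stage[OF that])
  have "(\<lambda>N. B N x y) \<longlonglongrightarrow> 0"
  proof (rule tendsto_zero_from_dense[where f = "\<lambda>N x. B N x y"])
    show "norm (B N x y - B N x' y) \<le> (2 + norm \<kappa>) * norm y * norm (x - x')" for N x x'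
      using bound[of N "x - x'" y] unfolding diff by (simp add: mult_ac)
    show "closure D = UNIV"
      unfolding D_def by (rule dense)
  qed (rule right)
  then show ?thesis
    unfolding B_def \<kappa>_def by (rule LIM_zero_cancel)
qed

lemma limit_value_eq_phi:
  assumes "p \<in> {-1..1}" "q = sqrt (1 - p\<^sup>2)"
  shows "1 - (even_value + odd_value) / 2 = phi p"
proof -
  have "p\<^sup>2 \<le> 1"
    using assms(1) by (simp add: abs_square_le_1 abs_le_iff)
  then have q2: "q\<^sup>2 = 1 - p\<^sup>2"
    using assms(2) by simp
  have "q ^ 4 = (q\<^sup>2)\<^sup>2"
    by simp
  then have q4: "q ^ 4 = (1 - p\<^sup>2)\<^sup>2"
    by (simp only: q2)
  show ?thesis
    unfolding even_value_def odd_value_def phi_def assms(2)[symmetric] q2 q4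
    by (simp add: power2_eq_square power4_eq_xxxx field_simps)
qed

end

theorem proposition4:
  fixes p q :: real
    and Pi1 :: "(nat \<Rightarrow> nat) \<Rightarrow> 'h \<Rightarrow> 'h::complex_hilbert_space"
  assumes "p \<in> {-1..1}"
    and "q = sqrt (1 - p\<^sup>2)"
    and "leading_component p q Pi1"
  shows "weak_operator_limit
    (\<lambda>N x. scaleC (1 / of_nat N) (extend_rep Pi1 (coxeter_laplace N) x))
    (\<lambda>x. scaleC (complex_of_real (phi p)) x)"
proof -
  obtain \<pi> J where "leading_component_model p q Pi1 \<pi> J"
    using assms(3) unfolding leading_component_def leading_component_model_def by blast
  then interpret leading_component_model p q Pi1 \<pi> J .
  show ?thesis
    unfolding weak_operator_limit_def
    using mean_laplace_weak_limit limit_value_eq_phi[OF assms(1,2)]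
    by (simp add: mean_laplace_def cinner_scaleC_left)
qed

end
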